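(* Let $\nu\in M_{\chi_\alpha}(E)$, and let $\gamma_i:E\to[0,\infty)$, $i=1,\ldots,q$, be finite-valued measurable functions satisfying $\gamma_i(S_rx)=r_i\gamma_i(x)$ for all $r\in G$, $x\in E$. With $\gamma_{h,i}$, $A_{\boldsymbol h}(r)$ and $p_{\boldsymbol h}$ as defined in the context, assume that $p_{\boldsymbol h}<\infty$ for every $\boldsymbol h\in\mathsf T^q$, and define $$K_\nu\bigl((r,\boldsymbol h),(s,\boldsymbol k)\bigr):=\nu\bigl(A_{\boldsymbol h}(r)\cap A_{\boldsymbol k}(s)\bigr),\qquad r,s\in G,\ \boldsymbol h,\boldsymbol k\in\mathsf T^q.$$ Then $K_\nu$ is a finite positive semidefinite kernel on $G\times\mathsf T^q$, and for all $a,r,s\in G$, $\boldsymbol h,\boldsymbol k\in\mathsf T^q$, $$K_\nu\bigl((ar,\boldsymbol h),(as,\boldsymbol k)\bigr)=\chi_\alpha(a)^{-1}K_\nu\bigl((r,\boldsymbol h),(s,\boldsymbol k)\bigr),\qquad K_\nu\bigl((r,\boldsymbol h),(s,\boldsymbol h)\bigr)=p_{\boldsymbol h}\,\chi_\alpha(r\vee s)^{-1},$$ where $(r\vee s)_i=\max(r_i,s_i)$. If $\nu$ is $B$-invariant, then $$K_\nu\bigl((r,u\boldsymbol h),(s,u\boldsymbol k)\bigr)=K_\nu\bigl((r,\boldsymbol h),(s,\boldsymbol k)\bigr),\qquad u\in\mathsf T.$$ If $Z$ is any stochastic representer of $\nu$, then $$K_\nu\bigl((r,\boldsymbol h),(s,\boldsymbol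 k)\bigr)=\mathbb E\left\{\prod_{i=1}^q\left[\left(\frac{\gamma_{h_i,i}(Z)}{r_i}\right)^{\alpha_i}\wedge\left(\frac{\gamma_{k_i,i}(Z)}{s_i}\right)^{\alpha_i}\right]\right\}.$$
   Context: Let $q\ge1$ be an integer, $(E,\mathcal E)$ an arbitrary measurable space, and $G=(0,\infty)^q$ with coordinatewise multiplication and its Borel $\sigma$-field. Let $S:G\times E\to E$, $(r,x)\mapsto S_rx$, be a jointly measurable left action: $S_{\boldsymbol 1}x=x$ with $\boldsymbol 1=(1,\ldots,1)$, and $S_r(S_sx)=S_{rs}x$. Fix $\alpha\in(0,\infty)^q$ and put $\chi_\alpha(r)=\prod_{i=1}^q r_i^{\alpha_i}$ and $\vartheta_\alpha(dr)=\prod_{i=1}^q\alpha_i r_i^{-\alpha_i-1}\,dr_i$ (a measure on $G$). A measure $\nu$ on $(E,\mathcal E)$ is $\chi_\alpha$-homogeneous if $\nu(S_rA)=\chi_\alpha(r)^{-1}\nu(A)$ for all $r\in G$, $A\in\mathcal E$. $M_{\chi_\alpha}(E)$ is the set of nonzero $\chi_\alpha$-homogeneous measures $\nu$ for which $0<\nu(A_\star)<\infty$ for some $A_\star\in\mathcal E$ (no $\sigma$-finiteness is assumed). For an $E$-valued random element $Z$, $\nu_Z(A)=\mathbb E\left\{\int_G\mathbb I_A(S_rZ)\,\vartheta_\alpha(dr)\right\}$, $A\in\mathcal E$; $Z$ is a stochastic representer of $\nu$ if $\nu=\nu_Z$. $\mathsf T$ is a locally compact second-countable Hausdorff group, and $B:\mathsf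 T\times E\to E$, $(a,x)\mapsto B^ax$, is a jointly measurable (left) action with $B^aS_rx=S_rB^ax$ for all $a\in\mathsf T$, $r\in G$, $x\in E$. A measure $\nu$ is $B$-invariant if $(B^a)_\#\nu=\nu$ for every $a\in\mathsf T$, where $(T_\#\nu)(A)=\nu(T^{-1}A)$. For $h\in\mathsf T$ put $\gamma_{h,i}(x)=\gamma_i(B^{h^{-1}}x)$. For $\boldsymbol h=(h_1,\ldots,h_q)\in\mathsf T^q$ and $r\in G$ put $A_{\boldsymbol h}(r)=\bigcap_{i=1}^q\{\gamma_{h_i,i}>r_i\}$, $A_{\boldsymbol h}=A_{\boldsymbol h}(\boldsymbol 1)$, $p_{\boldsymbol h}=\nu(A_{\boldsymbol h})$. For $u\in\mathsf T$, $u\boldsymbol h=(uh_1,\ldots,uh_q)$. A kernel $K$ on a set $X$ is positive semidefinite if $\sum_{\ell,m}c_\ell\overline{c_m}K(z_\ell,z_m)\ge0$ for all finite families $z_\ell\in X$, $c_\ell\in\mathbb C$. The symbol $\wedge$ denotes minimum. *)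

theory Defs
  imports "HOL-Probability.Probability"
begin

text \<open>
  Conventions.

  The group G of scalings is the set of vectors in \<open>real ^ 'q\<close> with positive
  coordinates; the product and the unit of \<open>real ^ 'q\<close> are the library's coordinatewise ones,
  and \<open>sup\<close> is the coordinatewise maximum.

  A measurable space is given as a value \<open>E\<close> of type \<open>'e measure\<close>, of which only
  \<open>space E\<close> and \<open>sets E\<close> are used.

  The group T is a type of class \<open>topological_group_add\<close>. The library has no class of
  multiplicative groups, and \<open>group_add\<close> does not assume commutativity; so \<open>u + h\<close>,
  \<open>- h\<close> and \<open>0\<close> stand for the product, the inverse and the unit of a group that need not be
  abelian.
\<close>

definition posG :: "(real ^ 'q::finite) set" where
  "posG = {r. \<forall>i. 0 < r $ i}"

text \<open>A jointly measurable left action on \<open>E\<close> of the group (or monoid) with the operation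
  \<open>opr\<close> and the unit \<open>e\<close> carried by the measurable space \<open>M\<close>.\<close>

definition measurable_action ::
  "'g measure \<Rightarrow> ('g \<Rightarrow> 'g \<Rightarrow> 'g) \<Rightarrow> 'g \<Rightarrow> 'e measure \<Rightarrow> ('g \<Rightarrow> 'e \<Rightarrow> 'e) \<Rightarrow> bool" where
  "measurable_action M opr e E S \<longleftrightarrow>
     (\<lambda>(g, x). S g x) \<in> (M \<Otimes>\<^sub>M E) \<rightarrow>\<^sub>M E \<and>
     (\<forall>x\<in>space E. S e x = x) \<and>
     (\<forall>g\<in>space M. \<forall>h\<in>space M. \<forall>x\<in>space E. S g (S h x) = S (opr g h) x)"

definition scaling_action :: "'e measure \<Rightarrow> (real ^ 'q::finite \<Rightarrow> 'e \<Rightarrow> 'e) \<Rightarrow> bool" where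
  "scaling_action E S \<longleftrightarrow> measurable_action (restrict_space borel posG) (*) 1 E S"

definition chi :: "real ^ 'q::finite \<Rightarrow> real ^ 'q \<Rightarrow> real" where
  "chi \<alpha> r = (\<Prod>i\<in>UNIV. (r $ i) powr (\<alpha> $ i))"

definition vartheta :: "real ^ 'q::finite \<Rightarrow> (real ^ 'q) measure" where
  "vartheta \<alpha> = density (restrict_space lborel posG)
     (\<lambda>r. ennreal (\<Prod>i\<in>UNIV. \<alpha> $ i * (r $ i) powr (- (\<alpha> $ i) - 1)))"

definition homogeneous ::
  "'e measure \<Rightarrow> (real ^ 'q::finite \<Rightarrow> 'e \<Rightarrow> 'e) \<Rightarrow> real ^ 'q \<Rightarrow> 'e measure \<Rightarrow> bool" where
  "homogeneous E S \<alpha> \<nu> \<longleftrightarrow> sets \<nu> = sets E \<and>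
     (\<forall>r\<in>posG. \<forall>A\<in>sets E. emeasure \<nu> (S r ` A) = ennreal (inverse (chi \<alpha> r)) * emeasure \<nu> A)"

definition M_chi ::
  "'e measure \<Rightarrow> (real ^ 'q::finite \<Rightarrow> 'e \<Rightarrow> 'e) \<Rightarrow> real ^ 'q \<Rightarrow> 'e measure set" where
  "M_chi E S \<alpha> = {\<nu>. homogeneous E S \<alpha> \<nu> \<and> emeasure \<nu> (space E) \<noteq> 0 \<and>
     (\<exists>A\<in>sets E. 0 < emeasure \<nu> A \<and> emeasure \<nu> A < \<infinity>)}"

text \<open>The set function induced by a random element \<open>Z\<close> on the probability space \<open>P\<close>.\<close>

definition nu_of ::
  "(real ^ 'q::finite \<Rightarrow> 'e \<Rightarrow> 'e) \<Rightarrow> real ^ 'q \<Rightarrow> 'w measure \<Rightarrow> ('w \<Rightarrow> 'e) \<Rightarrow> 'e set \<Rightarrow> ennreal" where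
  "nu_of S \<alpha> P Z A = (\<integral>\<^sup>+ w. (\<integral>\<^sup>+ r. indicator A (S r (Z w)) \<partial>vartheta \<alpha>) \<partial>P)"

definition stochastic_representer ::
  "'e measure \<Rightarrow> (real ^ 'q::finite \<Rightarrow> 'e \<Rightarrow> 'e) \<Rightarrow> real ^ 'q \<Rightarrow> 'e measure \<Rightarrow>
   'w measure \<Rightarrow> ('w \<Rightarrow> 'e) \<Rightarrow> bool" where
  "stochastic_representer E S \<alpha> \<nu> P Z \<longleftrightarrow>
     prob_space P \<and> Z \<in> P \<rightarrow>\<^sub>M E \<and> sets \<nu> = sets E \<and>
     (\<forall>A\<in>sets E. emeasure \<nu> A = nu_of S \<alpha> P Z A)"

definition invariant_measure :: "'e measure \<Rightarrow> ('t \<Rightarrow> 'e \<Rightarrow> 'e) \<Rightarrow> 'e measure \<Rightarrow> bool" where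
  "invariant_measure E B \<nu> \<longleftrightarrow> (\<forall>a. distr \<nu> E (B a) = \<nu>)"

definition shifted ::
  "('t::group_add \<Rightarrow> 'e \<Rightarrow> 'e) \<Rightarrow> ('q \<Rightarrow> 'e \<Rightarrow> real) \<Rightarrow> 't \<Rightarrow> 'q \<Rightarrow> 'e \<Rightarrow> real" where
  "shifted B \<gamma> h i x = \<gamma> i (B (- h) x)"

definition exceed ::
  "'e measure \<Rightarrow> ('t::group_add \<Rightarrow> 'e \<Rightarrow> 'e) \<Rightarrow> ('q::finite \<Rightarrow> 'e \<Rightarrow> real) \<Rightarrow>
   't ^ 'q \<Rightarrow> real ^ 'q \<Rightarrow> 'e set" where
  "exceed E B \<gamma> h r = (\<Inter>i. {x\<in>space E. r $ i < shifted B \<gamma> (h $ i) i x})"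

definition p_exceed ::
  "'e measure \<Rightarrow> ('t::group_add \<Rightarrow> 'e \<Rightarrow> 'e) \<Rightarrow> ('q::finite \<Rightarrow> 'e \<Rightarrow> real) \<Rightarrow>
   'e measure \<Rightarrow> 't ^ 'q \<Rightarrow> ennreal" where
  "p_exceed E B \<gamma> \<nu> h = emeasure \<nu> (exceed E B \<gamma> h 1)"

definition K_nu ::
  "'e measure \<Rightarrow> ('t::group_add \<Rightarrow> 'e \<Rightarrow> 'e) \<Rightarrow> ('q::finite \<Rightarrow> 'e \<Rightarrow> real) \<Rightarrow>
   'e measure \<Rightarrow> (real ^ 'q) \<times> ('t ^ 'q) \<Rightarrow> (real ^ 'q) \<times> ('t ^ 'q) \<Rightarrow> ennreal" where
  "K_nu E B \<gamma> \<nu> = (\<lambda>(r, h) (s, k). emeasure \<nu> (exceed E B \<gamma> h r \<inter> exceed E B \<gamma> k s))"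

definition left_mult :: "'t::plus \<Rightarrow> 't ^ 'q::finite \<Rightarrow> 't ^ 'q" where
  "left_mult u h = (\<chi> i. u + h $ i)"

definition psd_kernel :: "'x set \<Rightarrow> ('x \<Rightarrow> 'x \<Rightarrow> complex) \<Rightarrow> bool" where
  "psd_kernel X K \<longleftrightarrow> (\<forall>(n::nat) (z :: nat \<Rightarrow> 'x) (c :: nat \<Rightarrow> complex). (\<forall>l<n. z l \<in> X) \<longrightarrow>
     (\<Sum>l<n. \<Sum>m<n. c l * cnj (c m) * K (z l) (z m)) \<in> \<real>\<^sub>\<ge>\<^sub>0)"

end

theory Submission
  imports Defs
begin

text \<open>
  Everything rests on two observations about the exceedance sets \<open>A\<^sub>h(r)\<close>.

  First, the functions \<open>\<gamma>\<^sub>i\<close> are equivariant under the scalings and the action \<open>B\<close> commutes with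
  them, so a scaling by \<open>a\<close> carries \<open>A\<^sub>h(r)\<close> onto \<open>A\<^sub>h(a r)\<close> (lemma \<open>scaling_image_exceed\<close>).
  Homogeneity of \<open>\<nu>\<close> then gives the scaling identity, the finiteness of the kernel (compare with
  \<open>A\<^sub>h(r)\<close>, a scaled copy of \<open>A\<^sub>h\<close>) and, as \<open>A\<^sub>h(r) \<inter> A\<^sub>h(s) = A\<^sub>h(r \<or> s)\<close>, the formula on the
  diagonal \<open>h = k\<close>. In the same way \<open>A\<^bsub>uh\<^esub>(r)\<close> is the preimage of \<open>A\<^sub>h(r)\<close> under the inverse of
  \<open>B\<^sup>u\<close>, which gives the invariance under \<open>u\<close>.

  Secondly, the kernel is a Gram kernel: it is the \<open>L\<^sup>2(\<nu>)\<close> inner product of indicator functions, so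
  its quadratic form is the integral of \<open>\<bar>\<Sum>\<^sub>l c\<^sub>l 1\<^bsub>A\<^sub>l\<^esub>\<bar>\<^sup>2\<close> (lemma \<open>gram_sum_measure_Int_nonneg\<close>).

  For the representation by \<open>Z\<close>, fix an outcome and let \<open>x\<close> be the value of \<open>Z\<close>. The scalings \<open>g\<close>
  that put \<open>x\<close> into \<open>A\<^sub>h(r) \<inter> A\<^sub>k(s)\<close> are those with \<open>g\<^sub>i \<gamma>\<^bsub>h\<^sub>i,i\<^esub>(x) > r\<^sub>i\<close> and
  \<open>g\<^sub>i \<gamma>\<^bsub>k\<^sub>i,i\<^esub>(x) > s\<^sub>i\<close> for all \<open>i\<close>. They form an upper orthant, or the empty set if one of the
  values of \<open>\<gamma>\<close> vanishes. As \<open>\<vartheta>\<^sub>\<alpha>\<close> is a product of measures with power densities, an orthant with corner \<open>t\<close> has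
  mass \<open>\<Prod>\<^sub>i t\<^sub>i\<^bsup>-\<alpha>\<^sub>i\<^esup>\<close> (lemma \<open>vartheta_upper_orthant\<close>), which is the product of the minima.
\<close>

section \<open>The group of scalings\<close>

lemma sup_in_posG: "r \<in> posG \<Longrightarrow> sup r s \<in> posG"
  by (auto simp: posG_def sup_vec_def sup_real_def less_max_iff_disj)

lemma posG_inverse:
  assumes "r \<in> posG"
  shows "(\<chi> i. inverse (r $ i)) \<in> posG" "r * (\<chi> i. inverse (r $ i)) = 1"
  using assms by (auto simp: posG_def vec_eq_iff less_imp_neq[symmetric])

lemma posG_borel: "posG \<in> sets (borel :: (real ^ 'q::finite) measure)"
proof -
  have "posG = (\<Inter>i. {r :: real ^ 'q. 0 < r $ i})"
    by (auto simp: posG_def)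
  also have "open \<dots>"
    by (intro open_INT) (auto intro!: open_Collect_less continuous_intros)
  finally show ?thesis by simp
qed

lemma measurable_action_section:
  assumes "measurable_action M opr e E S" "g \<in> space M"
  shows "S g \<in> E \<rightarrow>\<^sub>M E"
proof -
  have "(\<lambda>(g, x). S g x) \<circ> (\<lambda>x. (g, x)) \<in> E \<rightarrow>\<^sub>M E"
    using assms by (intro measurable_comp[of _ _ "M \<Otimes>\<^sub>M E"]) (auto simp: measurable_action_def)
  then show ?thesis by (simp add: comp_def)
qed

lemma scaling_action_section:
  assumes "scaling_action E S" "r \<in> posG"
  shows "S r \<in> E \<rightarrow>\<^sub>M E"
  using assms measurable_action_section[of "restrict_space borel posG" "(*)" 1 E S r]
  by (simp add: scaling_action_def space_restrict_space)

lemma scaling_action_comp: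
  assumes "scaling_action E S" "r \<in> posG" "s \<in> posG" "x \<in> space E"
  shows "S r (S s x) = S (r * s) x"
  using assms by (simp add: scaling_action_def measurable_action_def space_restrict_space)

lemma scaling_action_one:
  assumes "scaling_action E S" "x \<in> space E"
  shows "S 1 x = x"
  using assms by (simp add: scaling_action_def measurable_action_def)

section \<open>Exceedance sets\<close>

lemma shifted_measurable:
  assumes "measurable_action (borel :: 't::{topological_group_add} measure) (+) 0 E B"
    and "\<forall>i. \<gamma> i \<in> borel_measurable E"
  shows "shifted B \<gamma> h i \<in> borel_measurable E"
proof -
  have [measurable]: "B (- h) \<in> E \<rightarrow>\<^sub>M E"
    using assms(1) by (rule measurable_action_section) simp
  have [measurable]: "\<gamma> i \<in> borel_measurable E"
    using assms(2) by blast
  show ?thesis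
    unfolding shifted_def by measurable
qed

lemma exceed_sets:
  assumes "measurable_action (borel :: 't::{topological_group_add} measure) (+) 0 E B"
    and "\<forall>i. \<gamma> i \<in> borel_measurable E"
  shows "exceed E B \<gamma> h r \<in> sets E"
proof -
  have [measurable]: "shifted B \<gamma> h i \<in> borel_measurable E" for h i
    using assms by (rule shifted_measurable)
  show ?thesis
    unfolding exceed_def by measurable
qed

lemma shifted_scaling:
  assumes "measurable_action (borel :: 't::{topological_group_add} measure) (+) 0 E B"
    and "\<forall>a. \<forall>r\<in>posG. \<forall>x\<in>space E. B a (S r x) = S r (B a x)"
    and "\<forall>i. \<forall>r\<in>posG. \<forall>x\<in>space E. \<gamma> i (S r x) = r $ i * \<gamma> i x"
    and "a \<in> posG" "x \<in> space E"
  shows "shifted B \<gamma> h i (S a x) = a $ i * shifted B \<gamma> h i x"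
proof -
  have "B (- h) x \<in> space E"
    using measurable_action_section[OF assms(1), of "- h"] assms(5) by (auto dest: measurable_space)
  with assms show ?thesis by (simp add: shifted_def)
qed

text \<open>The equivariance of the functions gives one inclusion; applied to the inverse scaling it gives
  the other.\<close>

lemma scaling_image_exceed:
  assumes S: "scaling_action E S"
    and B: "measurable_action (borel :: 't::{topological_group_add} measure) (+) 0 E B"
    and commute: "\<forall>a. \<forall>r\<in>posG. \<forall>x\<in>space E. B a (S r x) = S r (B a x)"
    and scale: "\<forall>i. \<forall>r\<in>posG. \<forall>x\<in>space E. \<gamma> i (S r x) = r $ i * \<gamma> i x"
    and a: "a \<in> posG"
  shows "S a ` (exceed E B \<gamma> h r \<inter> exceed E B \<gamma> k s)
    = exceed E B \<gamma> h (a * r) \<inter> exceed E B \<gamma> k (a * s)"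
proof -
  have fwd: "S b x \<in> exceed E B \<gamma> h (b * r)"
    if "b \<in> posG" "x \<in> exceed E B \<gamma> h r" for b x h r
  proof -
    have x: "x \<in> space E" using that(2) by (auto simp: exceed_def)
    have "S b x \<in> space E"
      using scaling_action_section[OF S that(1)] x by (auto dest: measurable_space)
    then show ?thesis
      using that x shifted_scaling[OF B commute scale that(1) x]
      by (auto simp: exceed_def posG_def)
  qed
  define b where "b = (\<chi> i. inverse (a $ i))"
  have b: "b \<in> posG" "a * b = 1"
    unfolding b_def using posG_inverse[OF a] by auto
  have ba: "b * (a * r) = r" for r
    using b(2) by (metis mult.assoc mult.commute mult_1)
  show ?thesis
  proof (intro equalityI subsetI)
    fix y assume y: "y \<in> exceed E B \<gamma> h (a * r) \<inter> exceed E B \<gamma> k (a * s)"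
    then have "y \<in> space E" by (auto simp: exceed_def)
    then have "y = S a (S b y)"
      using scaling_action_comp[OF S a b(1)] scaling_action_one[OF S] b(2) by simp
    moreover have "S b y \<in> exceed E B \<gamma> h r \<inter> exceed E B \<gamma> k s"
      using fwd[OF b(1), of y h "a * r"] fwd[OF b(1), of y k "a * s"] y by (simp add: ba)
    ultimately show "y \<in> S a ` (exceed E B \<gamma> h r \<inter> exceed E B \<gamma> k s)" by blast
  qed (use fwd[OF a] in blast)
qed

lemma exceed_Int_same: "exceed E B \<gamma> h r \<inter> exceed E B \<gamma> h s = exceed E B \<gamma> h (sup r s)"
  by (auto simp: exceed_def sup_vec_def sup_real_def)

lemma exceed_left_mult:
  assumes B: "measurable_action (borel :: 't::{topological_group_add} measure) (+) 0 E B"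
  shows "exceed E B \<gamma> (left_mult u h) r = B (- u) -` exceed E B \<gamma> h r \<inter> space E"
proof -
  have "B (- u) x \<in> space E" "shifted B \<gamma> (u + t) i x = shifted B \<gamma> t i (B (- u) x)"
    if "x \<in> space E" for x t i
    using that B measurable_action_section[OF B, of "- u"]
    by (auto simp: shifted_def measurable_action_def minus_add dest: measurable_space)
  then show ?thesis
    by (auto simp: exceed_def left_mult_def)
qed

section \<open>Gram sums of indicators\<close>

text \<open>The sum is the squared \<open>L\<^sup>2(M)\<close> norm of \<open>\<Sum>\<^sub>l c\<^sub>l 1\<^bsub>A\<^sub>l\<^esub>\<close>. The indicators are
  integrable because the sets have finite measure, so the double sum can be taken inside the
  integral.\<close>

lemma gram_sum_measure_Int_nonneg:
  fixes c :: "'i \<Rightarrow> complex"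
  assumes sets: "\<And>l. l \<in> I \<Longrightarrow> A l \<in> sets M"
    and fin: "\<And>l. l \<in> I \<Longrightarrow> emeasure M (A l) < \<infinity>"
  shows "(\<Sum>l\<in>I. \<Sum>m\<in>I. c l * cnj (c m) * complex_of_real (measure M (A l \<inter> A m))) \<in> \<real>\<^sub>\<ge>\<^sub>0"
proof -
  define f where "f x = (\<Sum>l\<in>I. c l * complex_of_real (indicator (A l) x))" for x
  have sq: "(\<Sum>l\<in>I. \<Sum>m\<in>I. c l * cnj (c m) * complex_of_real (indicator (A l \<inter> A m) x))
      = complex_of_real ((norm (f x))\<^sup>2)" for x
    unfolding complex_norm_square f_def
    by (simp add: sum_product indicator_inter_arith mult_ac)
  have int: "integrable M (\<lambda>x. c l * cnj (c m) * complex_of_real (indicator (A l \<inter> A m) x))"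
    if "l \<in> I" "m \<in> I" for l m
  proof -
    have "emeasure M (A l \<inter> A m) \<le> emeasure M (A l)"
      using that sets by (intro emeasure_mono) auto
    then have "emeasure M (A l \<inter> A m) < \<infinity>"
      using fin[OF that(1)] by (rule le_less_trans)
    then have "integrable M (indicator (A l \<inter> A m) :: _ \<Rightarrow> real)"
      using that sets by (intro integrable_real_indicator) auto
    then show ?thesis
      by (intro integrable_mult_right integrable_of_real)
  qed
  have "(\<Sum>l\<in>I. \<Sum>m\<in>I. c l * cnj (c m) * complex_of_real (measure M (A l \<inter> A m)))
      = (\<Sum>l\<in>I. \<Sum>m\<in>I. \<integral>x. c l * cnj (c m) * complex_of_real (indicator (A l \<inter> A m) x) \<partial>M)"
  proof (intro sum.cong refl)
    fix l m assume "l \<in> I" "m \<in> I"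
    then have "A l \<inter> A m \<inter> space M = A l \<inter> A m"
      using sets[THEN sets.sets_into_space] by blast
    then show "c l * cnj (c m) * complex_of_real (measure M (A l \<inter> A m))
      = (\<integral>x. c l * cnj (c m) * complex_of_real (indicator (A l \<inter> A m) x) \<partial>M)"
      by simp
  qed
  also have "\<dots> = (\<integral>x. (\<Sum>l\<in>I. \<Sum>m\<in>I. c l * cnj (c m) * complex_of_real (indicator (A l \<inter> A m) x)) \<partial>M)"
    using int by (simp add: Bochner_Integration.integral_sum Bochner_Integration.integrable_sum)
  also have "\<dots> = complex_of_real (\<integral>x. (norm (f x))\<^sup>2 \<partial>M)"
    by (simp only: sq integral_complex_of_real)
  finally show ?thesis
    by (simp add: nonneg_Reals_of_real_iff)
qed

section \<open>The measure of an orthant\<close>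

lemma nn_integral_power_tail:
  fixes a t :: real
  assumes a: "0 < a" and t: "0 < t"
  shows "(\<integral>\<^sup>+ x. ennreal (a * x powr (- a - 1)) * indicator {t<..} x \<partial>lborel) = ennreal (t powr - a)"
proof -
  have "(\<integral>\<^sup>+ x. ennreal (a * x powr (- a - 1)) * indicator {t<..} x \<partial>lborel)
      = (\<integral>\<^sup>+ x. ennreal (a * x powr (- a - 1)) * indicator {t..} x \<partial>lborel)"
    by (intro nn_integral_cong_AE AE_I'[of "{t}"]) (auto simp: indicator_def)
  also have "\<dots> = ennreal (0 - (- (t powr - a)))"
  proof (rule nn_integral_FTC_atLeast)
    show "((\<lambda>x. - (x powr - a)) has_real_derivative a * x powr (- a - 1)) (at x)" if "t \<le> x" for x
      using that t by (auto intro!: derivative_eq_intros)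
    have "((\<lambda>x::real. x powr - a) \<longlongrightarrow> 0) at_top"
      using a by (intro tendsto_neg_powr filterlim_ident) auto
    then show "((\<lambda>x. - (x powr - a)) \<longlongrightarrow> 0) at_top"
      by (auto dest: tendsto_minus)
  qed (use a in auto)
  finally show ?thesis by simp
qed

text \<open>The density and the indicator of the orthant are both products over the coordinates, so
  Tonelli's theorem reduces the integral to one power tail in each coordinate.\<close>

lemma vartheta_upper_orthant:
  fixes \<alpha> t :: "real ^ 'q::finite"
  assumes alpha: "\<alpha> \<in> posG" and t: "t \<in> posG"
  shows "(\<integral>\<^sup>+ r. indicator {r. \<forall>i. t $ i < r $ i} r \<partial>vartheta \<alpha>)
    = ennreal (\<Prod>i\<in>UNIV. (t $ i) powr - (\<alpha> $ i))"
proof -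
  let ?O = "{r :: real ^ 'q. \<forall>i. t $ i < r $ i}"
  let ?d = "\<lambda>r :: real ^ 'q. \<Prod>i\<in>UNIV. \<alpha> $ i * (r $ i) powr (- (\<alpha> $ i) - 1)"
  \<comment> \<open>\<open>nn_integral_lborel_prod\<close> runs over basis vectors; \<open>?ix\<close> recovers the coordinate index.\<close>
  let ?ix = "\<lambda>b :: real ^ 'q. THE i. b = axis i 1"
  define F where "F i x = ennreal (\<alpha> $ i * x powr (- (\<alpha> $ i) - 1)) * indicator {t $ i<..} x"
    for i and x :: real
  have pos: "0 < \<alpha> $ i" "0 < t $ i" for i
    using alpha t by (auto simp: posG_def)
  have ix: "?ix (axis i 1) = i" for i
    by (rule the_equality) (auto simp: axis_eq_axis)
  have inj: "inj (\<lambda>i. axis i (1::real) :: real ^ 'q)"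
    by (auto simp: inj_on_def axis_eq_axis)
  have basis: "(Basis :: (real ^ 'q) set) = range (\<lambda>i. axis i 1)"
    by (auto simp: Basis_vec_def)
  have Basis_prod: "(\<Prod>b\<in>Basis. g b) = (\<Prod>i\<in>UNIV. g (axis i 1))" for g :: "real ^ 'q \<Rightarrow> ennreal"
    unfolding basis by (subst prod.reindex[OF inj]) simp
  have O: "?O \<in> sets borel"
    unfolding Collect_all_eq by (intro borel_open open_INT) (auto intro!: open_Collect_less continuous_intros)
  have d: "?d \<in> borel_measurable borel"
    by measurable
  have "(\<integral>\<^sup>+ r. indicator ?O r \<partial>vartheta \<alpha>)
      = (\<integral>\<^sup>+ r. ennreal (?d r) * indicator ?O r \<partial>restrict_space lborel posG)"
    unfolding vartheta_def
    by (rule nn_integral_density) (use d O in \<open>auto intro!: measurable_restrict_space1\<close>)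
  also have "\<dots> = (\<integral>\<^sup>+ r. ennreal (?d r) * indicator ?O r * indicator posG r \<partial>lborel)"
    by (rule nn_integral_restrict_space) (simp add: posG_borel)
  also have "\<dots> = (\<integral>\<^sup>+ r. (\<Prod>i\<in>UNIV. F i (r $ i)) \<partial>lborel)"
  proof (rule nn_integral_cong)
    fix r :: "real ^ 'q"
    show "ennreal (?d r) * indicator ?O r * indicator posG r = (\<Prod>i\<in>UNIV. F i (r $ i))"
    proof (cases "r \<in> ?O")
      case True
      then have "r \<in> posG"
        using pos(2) by (auto simp: posG_def intro: less_trans)
      then show ?thesis
        using True pos(1) by (simp add: F_def prod_ennreal less_imp_le)
    next
      case False
      then obtain i where "\<not> t $ i < r $ i" by auto
      then have "F i (r $ i) = 0" by (simp add: F_def)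
      then have "(\<Prod>i\<in>UNIV. F i (r $ i)) = 0"
        by (intro prod_zero) auto
      with False show ?thesis by simp
    qed
  qed
  also have "\<dots> = (\<integral>\<^sup>+ r. (\<Prod>b\<in>Basis. F (?ix b) (r \<bullet> b)) \<partial>lborel)"
    by (simp add: Basis_prod ix inner_axis)
  also have "\<dots> = (\<Prod>b\<in>Basis. \<integral>\<^sup>+ x. F (?ix b) x \<partial>lborel)"
    by (rule nn_integral_lborel_prod) (auto simp: F_def)
  also have "\<dots> = (\<Prod>i\<in>UNIV. ennreal ((t $ i) powr - (\<alpha> $ i)))"
    using pos by (simp add: Basis_prod ix F_def nn_integral_power_tail)
  also have "\<dots> = ennreal (\<Prod>i\<in>UNIV. (t $ i) powr - (\<alpha> $ i))"
    by (simp add: prod_ennreal)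
  finally show ?thesis .
qed

text \<open>With all \<open>u\<^sub>i\<close> and \<open>v\<^sub>i\<close> positive, the corner of the orthant is \<open>r/u \<or> s/v\<close>. If one of them
  is zero, both sides vanish, the right one because \<open>0 powr a = 0\<close>.\<close>

lemma vartheta_joint_exceedance:
  fixes \<alpha> r s :: "real ^ 'q::finite" and u v :: "'q \<Rightarrow> real"
  assumes alpha: "\<alpha> \<in> posG" and r: "r \<in> posG" and s: "s \<in> posG"
    and u: "\<And>i. 0 \<le> u i" and v: "\<And>i. 0 \<le> v i"
  shows "(\<integral>\<^sup>+ g. indicator {g. \<forall>i. r $ i < g $ i * u i \<and> s $ i < g $ i * v i} g \<partial>vartheta \<alpha>)
    = ennreal (\<Prod>i\<in>UNIV. min ((u i / r $ i) powr (\<alpha> $ i)) ((v i / s $ i) powr (\<alpha> $ i)))"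
proof (cases "\<forall>i. 0 < u i \<and> 0 < v i")
  case True
  define t :: "real ^ 'q" where "t = (\<chi> i. max (r $ i / u i) (s $ i / v i))"
  have pos: "0 < \<alpha> $ i" "0 < r $ i" "0 < s $ i" "0 < u i" "0 < v i" for i
    using alpha r s True by (auto simp: posG_def)
  have t: "t \<in> posG"
    using pos by (simp add: posG_def t_def less_max_iff_disj)
  have "{g. \<forall>i. r $ i < g $ i * u i \<and> s $ i < g $ i * v i} = {g. \<forall>i. t $ i < g $ i}"
    using pos by (simp add: t_def pos_divide_less_eq)
  moreover have "(t $ i) powr - (\<alpha> $ i)
      = min ((u i / r $ i) powr (\<alpha> $ i)) ((v i / s $ i) powr (\<alpha> $ i))" for i
  proof -
    have inv: "(x / y) powr - (\<alpha> $ i) = (y / x) powr (\<alpha> $ i)" if "0 < x" "0 < y" for x y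
      using that by (simp add: powr_minus powr_divide)
    have "(max x y) powr - (\<alpha> $ i) = min (x powr - (\<alpha> $ i)) (y powr - (\<alpha> $ i))"
      if "0 < x" "0 < y" for x y
      using that pos(1)[of i] powr_mono2'[of "- (\<alpha> $ i)" x y] powr_mono2'[of "- (\<alpha> $ i)" y x]
      by (auto simp: max_def min_def)
    then show ?thesis
      using pos by (simp add: t_def inv)
  qed
  ultimately show ?thesis
    using vartheta_upper_orthant[OF alpha t] by simp
next
  case False
  then obtain j where j: "u j = 0 \<or> v j = 0"
    using u v by (metis order_le_less)
  have pos: "0 < r $ i" "0 < s $ i" for i
    using r s by (auto simp: posG_def)
  have "min ((u j / r $ j) powr (\<alpha> $ j)) ((v j / s $ j) powr (\<alpha> $ j)) = 0"
    using j by (auto simp: min_def intro: antisym)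
  then have zero: "(\<Prod>i\<in>UNIV. min ((u i / r $ i) powr (\<alpha> $ i)) ((v i / s $ i) powr (\<alpha> $ i))) = 0"
    by (intro prod_zero) auto
  have empty: "{g. \<forall>i. r $ i < g $ i * u i \<and> s $ i < g $ i * v i} = {}"
    using j pos[of j] by (auto intro!: exI[of _ j])
  show ?thesis
    unfolding zero empty by simp
qed

section \<open>The kernel\<close>

theorem corollary4p2:
  fixes E :: "'e measure"
    and S :: "real ^ 'q::finite \<Rightarrow> 'e \<Rightarrow> 'e"
    and \<alpha> :: "real ^ 'q"
    and B :: "'t::{topological_group_add, second_countable_topology, t2_space} \<Rightarrow> 'e \<Rightarrow> 'e"
    and \<gamma> :: "'q \<Rightarrow> 'e \<Rightarrow> real"
    and \<nu> :: "'e measure"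
  assumes S: "scaling_action E S"
    and alpha: "\<alpha> \<in> posG"
    and T: "locally_compact_space (euclidean :: 't topology)"
    and B: "measurable_action (borel :: 't measure) (+) 0 E B"
    and commute: "\<forall>a. \<forall>r\<in>posG. \<forall>x\<in>space E. B a (S r x) = S r (B a x)"
    and nu: "\<nu> \<in> M_chi E S \<alpha>"
    and gamma_measurable: "\<forall>i. \<gamma> i \<in> borel_measurable E"
    and gamma_nonneg: "\<forall>i. \<forall>x\<in>space E. 0 \<le> \<gamma> i x"
    and gamma_scale: "\<forall>i. \<forall>r\<in>posG. \<forall>x\<in>space E. \<gamma> i (S r x) = r $ i * \<gamma> i x"
    and p_finite: "\<forall>h. p_exceed E B \<gamma> \<nu> h < \<infinity>"
  shows
    "(\<forall>z\<in>posG \<times> UNIV. \<forall>w\<in>posG \<times> UNIV. K_nu E B \<gamma> \<nu> z w < \<infinity>) \<and>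
     psd_kernel (posG \<times> UNIV) (\<lambda>z w. complex_of_real (enn2real (K_nu E B \<gamma> \<nu> z w))) \<and>
     (\<forall>a\<in>posG. \<forall>r\<in>posG. \<forall>s\<in>posG. \<forall>h k.
        K_nu E B \<gamma> \<nu> (a * r, h) (a * s, k)
          = ennreal (inverse (chi \<alpha> a)) * K_nu E B \<gamma> \<nu> (r, h) (s, k)) \<and>
     (\<forall>r\<in>posG. \<forall>s\<in>posG. \<forall>h.
        K_nu E B \<gamma> \<nu> (r, h) (s, h)
          = p_exceed E B \<gamma> \<nu> h * ennreal (inverse (chi \<alpha> (sup r s)))) \<and>
     (invariant_measure E B \<nu> \<longrightarrow>
        (\<forall>u. \<forall>r\<in>posG. \<forall>s\<in>posG. \<forall>h k.
           K_nu E B \<gamma> \<nu> (r, left_mult u h) (s, left_mult u k) = K_nu E B \<gamma> \<nu> (r, h) (s, k))) \<and>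
     (\<forall>(P :: 'w measure) Z. stochastic_representer E S \<alpha> \<nu> P Z \<longrightarrow>
        (\<forall>r\<in>posG. \<forall>s\<in>posG. \<forall>h k.
           K_nu E B \<gamma> \<nu> (r, h) (s, k)
             = (\<integral>\<^sup>+ w. ennreal (\<Prod>i\<in>UNIV.
                  min ((shifted B \<gamma> (h $ i) i (Z w) / r $ i) powr (\<alpha> $ i))
                      ((shifted B \<gamma> (k $ i) i (Z w) / s $ i) powr (\<alpha> $ i))) \<partial>P)))"
proof -
  have sets_nu: "sets \<nu> = sets E"
    and hom: "\<And>r A. r \<in> posG \<Longrightarrow> A \<in> sets E \<Longrightarrow>
      emeasure \<nu> (S r ` A) = ennreal (inverse (chi \<alpha> r)) * emeasure \<nu> A"
    using nu by (auto simp: M_chi_def homogeneous_def)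
  note space_nu = sets_eq_imp_space_eq[OF sets_nu]
  note ex_sets = exceed_sets[OF B gamma_measurable]
  have scaling: "K_nu E B \<gamma> \<nu> (a * r, h) (a * s, k)
      = ennreal (inverse (chi \<alpha> a)) * K_nu E B \<gamma> \<nu> (r, h) (s, k)" if "a \<in> posG" for a r s h k
    using hom[OF that, of "exceed E B \<gamma> h r \<inter> exceed E B \<gamma> k s"] ex_sets
    by (simp add: K_nu_def scaling_image_exceed[OF S B commute gamma_scale that] sets.Int)
  have single: "emeasure \<nu> (exceed E B \<gamma> h r) = p_exceed E B \<gamma> \<nu> h * ennreal (inverse (chi \<alpha> r))"
    if "r \<in> posG" for r h
    using scaling[OF that, of 1 h 1 h] by (simp add: K_nu_def p_exceed_def mult.commute)
  have single_fin: "emeasure \<nu> (exceed E B \<gamma> h r) < \<infinity>" if "r \<in> posG" for r h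
    using p_finite single[OF that, of h] by (simp add: ennreal_mult_less_top)
  have finite: "K_nu E B \<gamma> \<nu> z w < \<infinity>" if "z \<in> posG \<times> UNIV" for z w
  proof -
    obtain r h s k where zw: "z = (r, h)" "w = (s, k)" by fastforce
    have "K_nu E B \<gamma> \<nu> z w \<le> emeasure \<nu> (exceed E B \<gamma> h r)"
      unfolding zw K_nu_def using ex_sets sets_nu by (auto intro!: emeasure_mono)
    also have "\<dots> < \<infinity>"
      using single_fin that zw by simp
    finally show ?thesis .
  qed
  have psd: "psd_kernel (posG \<times> UNIV) (\<lambda>z w. complex_of_real (enn2real (K_nu E B \<gamma> \<nu> z w)))"
    unfolding psd_kernel_def
  proof (intro allI impI)
    fix n :: nat and z :: "nat \<Rightarrow> (real ^ 'q) \<times> ('t ^ 'q)" and c :: "nat \<Rightarrow> complex"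
    assume z: "\<forall>l<n. z l \<in> posG \<times> UNIV"
    define A where "A l = exceed E B \<gamma> (snd (z l)) (fst (z l))" for l
    have K: "enn2real (K_nu E B \<gamma> \<nu> (z l) (z m)) = measure \<nu> (A l \<inter> A m)" for l m
      by (simp add: K_nu_def A_def measure_def case_prod_beta)
    show "(\<Sum>l<n. \<Sum>m<n. c l * cnj (c m) * complex_of_real (enn2real (K_nu E B \<gamma> \<nu> (z l) (z m))))
        \<in> \<real>\<^sub>\<ge>\<^sub>0"
      unfolding K
    proof (rule gram_sum_measure_Int_nonneg)
      show "A l \<in> sets \<nu>" for l
        using ex_sets sets_nu by (simp add: A_def)
      show "emeasure \<nu> (A l) < \<infinity>" if "l \<in> {..<n}" for l
        unfolding A_def using z that by (intro single_fin) (auto simp: mem_Times_iff)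
    qed
  qed
  have diagonal: "K_nu E B \<gamma> \<nu> (r, h) (s, h)
      = p_exceed E B \<gamma> \<nu> h * ennreal (inverse (chi \<alpha> (sup r s)))" if "r \<in> posG" for r s h
    using single[OF sup_in_posG[OF that]] by (simp add: K_nu_def exceed_Int_same)
  have invariant: "K_nu E B \<gamma> \<nu> (r, left_mult u h) (s, left_mult u k) = K_nu E B \<gamma> \<nu> (r, h) (s, k)"
    if "invariant_measure E B \<nu>" for u r s h k
  proof -
    let ?A = "exceed E B \<gamma> h r \<inter> exceed E B \<gamma> k s"
    have meas: "B (- u) \<in> \<nu> \<rightarrow>\<^sub>M E"
      using measurable_action_section[OF B, of "- u"] by (simp add: measurable_cong_sets[OF sets_nu refl])
    have "emeasure \<nu> (B (- u) -` ?A \<inter> space \<nu>) = emeasure (distr \<nu> E (B (- u))) ?A"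
      using meas ex_sets by (intro emeasure_distr[symmetric]) auto
    also have "\<dots> = emeasure \<nu> ?A"
      using that by (simp add: invariant_measure_def)
    finally show ?thesis
      by (simp add: K_nu_def exceed_left_mult[OF B] space_nu Int_ac vimage_Int)
  qed
  have represent: "K_nu E B \<gamma> \<nu> (r, h) (s, k)
      = (\<integral>\<^sup>+ w. ennreal (\<Prod>i\<in>UNIV.
           min ((shifted B \<gamma> (h $ i) i (Z w) / r $ i) powr (\<alpha> $ i))
               ((shifted B \<gamma> (k $ i) i (Z w) / s $ i) powr (\<alpha> $ i))) \<partial>P)"
    if rep: "stochastic_representer E S \<alpha> \<nu> P Z" and r: "r \<in> posG" and s: "s \<in> posG"
    for P :: "'w measure" and Z r s h k
  proof -
    let ?A = "exceed E B \<gamma> h r \<inter> exceed E B \<gamma> k s"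
    have Z: "Z \<in> P \<rightarrow>\<^sub>M E"
      using rep by (simp add: stochastic_representer_def)
    have "K_nu E B \<gamma> \<nu> (r, h) (s, k) = nu_of S \<alpha> P Z ?A"
      using rep ex_sets by (simp add: K_nu_def stochastic_representer_def sets.Int)
    also have "\<dots> = (\<integral>\<^sup>+ w. ennreal (\<Prod>i\<in>UNIV.
           min ((shifted B \<gamma> (h $ i) i (Z w) / r $ i) powr (\<alpha> $ i))
               ((shifted B \<gamma> (k $ i) i (Z w) / s $ i) powr (\<alpha> $ i))) \<partial>P)"
      unfolding nu_of_def
    proof (rule nn_integral_cong)
      fix w assume "w \<in> space P"
      then have x: "Z w \<in> space E"
        using Z by (auto dest: measurable_space)
      have nonneg: "0 \<le> shifted B \<gamma> t i (Z w)" for t i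
        using measurable_space[OF measurable_action_section[OF B, of "- t"] x] gamma_nonneg
        by (simp add: shifted_def)
      have "(\<integral>\<^sup>+ g. indicator ?A (S g (Z w)) \<partial>vartheta \<alpha>)
          = (\<integral>\<^sup>+ g. indicator {g. \<forall>i. r $ i < g $ i * shifted B \<gamma> (h $ i) i (Z w)
              \<and> s $ i < g $ i * shifted B \<gamma> (k $ i) i (Z w)} g \<partial>vartheta \<alpha>)"
      proof (rule nn_integral_cong)
        fix g assume "g \<in> space (vartheta \<alpha>)"
        then have g: "g \<in> posG"
          by (simp add: vartheta_def space_restrict_space)
        have "S g (Z w) \<in> space E"
          using measurable_space[OF scaling_action_section[OF S g] x] .
        then show "indicator ?A (S g (Z w))
            = (indicator {g. \<forall>i. r $ i < g $ i * shifted B \<gamma> (h $ i) i (Z w)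
              \<and> s $ i < g $ i * shifted B \<gamma> (k $ i) i (Z w)} g :: ennreal)"
          using shifted_scaling[OF B commute gamma_scale g x]
          by (auto simp: exceed_def indicator_def)
      qed
      also have "\<dots> = ennreal (\<Prod>i\<in>UNIV.
           min ((shifted B \<gamma> (h $ i) i (Z w) / r $ i) powr (\<alpha> $ i))
               ((shifted B \<gamma> (k $ i) i (Z w) / s $ i) powr (\<alpha> $ i)))"
        by (rule vartheta_joint_exceedance[OF alpha r s nonneg nonneg])
      finally show "(\<integral>\<^sup>+ g. indicator ?A (S g (Z w)) \<partial>vartheta \<alpha>) = ennreal (\<Prod>i\<in>UNIV.
           min ((shifted B \<gamma> (h $ i) i (Z w) / r $ i) powr (\<alpha> $ i))
               ((shifted B \<gamma> (k $ i) i (Z w) / s $ i) powr (\<alpha> $ i)))" .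
    qed
    finally show ?thesis .
  qed
  show ?thesis
    by (intro conjI ballI allI impI) (rule finite psd scaling diagonal invariant represent; assumption)+
qed

end
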